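(* Let $n \ge 1$. Every system of $k > n$ point masses in $\mathbb{R}^n$ can be decomposed into at most $k-n$ systems of $n+1$ point masses, all of which have the same center of mass as the original system.
   Context: A system of $k$ point masses in $\mathbb{R}^n$ consists of points $\bm{a}_1,\ldots,\bm{a}_k \in \mathbb{R}^n$ (positions, not necessarily distinct) and positive numbers $m_1,\ldots,m_k$ (masses). Its center of mass is $\frac{m_1 \bm{a}_1 + \cdots + m_k \bm{a}_k}{m_1 + \cdots + m_k}$. A system is decomposed into finitely many systems if, for every $\bm{x} \in \mathbb{R}^n$, the total mass located at $\bm{x}$ in the original system equals the sum, over the systems of the decomposition, of the total mass located at $\bm{x}$ (so the mass of a point may be split among several point masses at the same position). *)

theory Defs
  imports "HOL-Analysis.Analysis"
begin

text \<open>
  A point mass is a pair (position, mass). A system of point masses is a list of such pairs: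
  repeated entries and repeated positions are allowed, and a mass must be strictly positive.
\<close>

type_synonym 'n point_mass = "(real ^ 'n) \<times> real"

definition point_mass_system :: "nat \<Rightarrow> ('n::finite) point_mass list \<Rightarrow> bool" where
  "point_mass_system k S \<longleftrightarrow> length S = k \<and> (\<forall>(a, m) \<in> set S. m > 0)"

definition total_mass :: "('n::finite) point_mass list \<Rightarrow> real" where
  "total_mass S = (\<Sum>(a, m)\<leftarrow>S. m)"

definition center_of_mass :: "('n::finite) point_mass list \<Rightarrow> real ^ 'n" where
  "center_of_mass S = (\<Sum>(a, m)\<leftarrow>S. m *\<^sub>R a) /\<^sub>R total_mass S"

definition mass_at :: "('n::finite) point_mass list \<Rightarrow> real ^ 'n \<Rightarrow> real" where
  "mass_at S x = (\<Sum>(a, m)\<leftarrow>S. if a = x then m else 0)"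

text \<open>
  The decomposing systems also form a list, so that the same system may be used more than once.
\<close>

definition decomposes_into ::
    "('n::finite) point_mass list \<Rightarrow> 'n point_mass list list \<Rightarrow> bool" where
  "decomposes_into S Ts \<longleftrightarrow> (\<forall>x. mass_at S x = (\<Sum>T\<leftarrow>Ts. mass_at T x))"

end

theory Submission
  imports Defs
begin

text \<open>
  Only the function \<^term>\<open>mass_at S\<close> matters, both for decomposing \<open>S\<close> and for its center of
  mass, so the argument is about nonnegative, finitely supported functions \<open>m\<close> on \<open>\<real>\<^sup>n\<close>.
  Such an \<open>m\<close> has center of mass \<open>c\<close> exactly when the moments \<open>m x (x - c)\<close> add up to zero, a
  condition that is linear in \<open>m\<close> and therefore survives subtraction.

  If the support of \<open>m\<close> has at most \<open>n + 1\<close> points, then \<open>m\<close> is the mass function of one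
  system of exactly \<open>n + 1\<close> point masses, because halving a point mass lengthens a system without
  changing its mass function. If the support is larger, then \<open>c\<close> lies in its convex hull, and
  Caratheodory's theorem writes \<open>c\<close> as a convex combination, with weights \<open>u\<close>, of at most
  \<open>n + 1\<close> points of the support. For the largest \<open>t\<close> with \<open>t u \<le> m\<close> the function \<open>t u\<close> is one
  system of the decomposition, and \<open>m - t u\<close> is balanced about \<open>c\<close> again and vanishes at some
  point of the support of \<open>m\<close>. Induction on the size of the support needs at most one system for each
  support point beyond \<open>n + 1\<close>, plus one. The support has at most \<open>k\<close> points, so \<open>k - n\<close> systems
  suffice.
\<close>

section \<open>Mass functions of systems\<close>

lemma sum_list_eq_sum_mass_at:
  fixes T :: "('n::finite) point_mass list" and f :: "real ^ 'n \<Rightarrow> 'b::real_vector"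
  assumes "finite A" and "fst ` set T \<subseteq> A"
  shows "(\<Sum>(a, m)\<leftarrow>T. m *\<^sub>R f a) = (\<Sum>x\<in>A. mass_at T x *\<^sub>R f x)"
  using assms(2)
proof (induction T)
  case Nil
  then show ?case by (simp add: mass_at_def)
next
  case (Cons p T)
  obtain a m where p: "p = (a, m)" by (cases p)
  have "(\<Sum>x\<in>A. mass_at (p # T) x *\<^sub>R f x)
      = (\<Sum>x\<in>A. (if a = x then m *\<^sub>R f x else 0) + mass_at T x *\<^sub>R f x)"
    by (rule sum.cong) (auto simp: mass_at_def p scaleR_left_distrib)
  also have "\<dots> = m *\<^sub>R f a + (\<Sum>x\<in>A. mass_at T x *\<^sub>R f x)"
    using Cons.prems assms(1) by (simp add: sum.distrib p)
  finally show ?case using Cons by (simp add: p)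
qed

lemma mass_at_nonneg:
  assumes "point_mass_system k T"
  shows "mass_at T x \<ge> 0"
  using assms unfolding mass_at_def point_mass_system_def
  by (intro sum_list_nonneg) auto

lemma support_mass_at:
  assumes "point_mass_system k T"
  shows "{x. mass_at T x \<noteq> 0} = fst ` set T"
proof -
  have "\<forall>(a, m)\<in>set T. m > 0" using assms by (simp add: point_mass_system_def)
  then have "mass_at T x \<ge> 0 \<and> (mass_at T x \<noteq> 0 \<longleftrightarrow> x \<in> fst ` set T)" for x
    by (induction T) (auto simp: mass_at_def split: if_splits)
  then show ?thesis by auto
qed

definition balanced_about :: "real ^ ('n::finite) \<Rightarrow> (real ^ 'n \<Rightarrow> real) \<Rightarrow> bool" where
  "balanced_about c m \<longleftrightarrow> (\<Sum>x | m x \<noteq> 0. m x *\<^sub>R (x - c)) = 0"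

lemma balanced_about_iff_sum:
  assumes "finite A" and "{x. m x \<noteq> 0} \<subseteq> A"
  shows "balanced_about c m \<longleftrightarrow> (\<Sum>x\<in>A. m x *\<^sub>R (x - c)) = 0"
proof -
  have "(\<Sum>x | m x \<noteq> 0. m x *\<^sub>R (x - c)) = (\<Sum>x\<in>A. m x *\<^sub>R (x - c))"
    using assms by (intro sum.mono_neutral_left) auto
  then show ?thesis by (simp add: balanced_about_def)
qed

lemma center_of_mass_eq_iff_balanced:
  assumes T: "point_mass_system k T" and "k > 0"
  shows "center_of_mass T = c \<longleftrightarrow> balanced_about c (mass_at T)"
proof -
  have "T \<noteq> []" using assms by (auto simp: point_mass_system_def)
  moreover have "\<forall>(a, m)\<in>set T. m > 0" using T by (simp add: point_mass_system_def)
  ultimately have pos: "total_mass T > 0"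
    unfolding total_mass_def
  proof (induction T rule: list_nonempty_induct)
    case (cons p T) then show ?case by (auto simp: add_pos_pos split: prod.splits)
  qed auto
  have "(\<Sum>x | mass_at T x \<noteq> 0. mass_at T x *\<^sub>R (x - c)) = (\<Sum>(a, m)\<leftarrow>T. m *\<^sub>R (a - c))"
    by (subst sum_list_eq_sum_mass_at[of "fst ` set T"]) (simp_all add: support_mass_at[OF T])
  also have "\<dots> = (\<Sum>(a, m)\<leftarrow>T. m *\<^sub>R a) - total_mass T *\<^sub>R c"
    unfolding total_mass_def by (induction T) (auto simp: algebra_simps)
  finally have "balanced_about c (mass_at T) \<longleftrightarrow> (\<Sum>(a, m)\<leftarrow>T. m *\<^sub>R a) = total_mass T *\<^sub>R c"
    by (simp add: balanced_about_def)
  then show ?thesis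
    using pos by (auto simp: center_of_mass_def divideR_right)
qed

section \<open>Realising a mass function by a system of prescribed length\<close>

text \<open>
  Halving the first point mass makes a system one longer; this is how the systems get exactly
  the required length although their supports may be smaller.
\<close>

lemma point_mass_system_with_mass_function:
  fixes m :: "real ^ ('n::finite) \<Rightarrow> real"
  assumes fin: "finite {x. m x \<noteq> 0}" and nonneg: "\<And>x. m x \<ge> 0"
    and nonempty: "{x. m x \<noteq> 0} \<noteq> {}" and "card {x. m x \<noteq> 0} \<le> N"
  shows "\<exists>T. point_mass_system N T \<and> mass_at T = m"
  using assms(4)
proof (induction N rule: dec_induct)
  case base
  obtain xs where xs: "distinct xs" "set xs = {x. m x \<noteq> 0}"
    using finite_distinct_list[OF fin] by blast
  let ?T = "map (\<lambda>x. (x, m x)) xs"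
  have "point_mass_system (card {x. m x \<noteq> 0}) ?T"
    using xs nonneg distinct_card[OF xs(1)]
    by (auto simp: point_mass_system_def less_le)
  moreover have "mass_at ?T x = m x" for x
  proof -
    have "mass_at ?T x = (\<Sum>a\<leftarrow>xs. if a = x then m a else 0)"
      by (simp add: mass_at_def o_def)
    also have "\<dots> = (\<Sum>a\<in>set xs. if a = x then m a else 0)"
      using xs(1) by (simp add: sum_list_distinct_conv_sum_set)
    finally show ?thesis by (simp add: xs(2) sum.delta[OF fin])
  qed
  ultimately show ?case by blast
next
  case (step N)
  then obtain T where T: "point_mass_system N T" "mass_at T = m" by blast
  have "card {x. m x \<noteq> 0} > 0" using fin nonempty by (simp add: card_gt_0_iff)
  then have "length T > 0" using step T by (simp add: point_mass_system_def)
  then obtain a r T' where T': "T = (a, r) # T'" by (cases T) auto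
  have "point_mass_system (Suc N) ((a, r / 2) # (a, r / 2) # T')"
    using T(1) by (auto simp: point_mass_system_def T')
  moreover have "mass_at ((a, r / 2) # (a, r / 2) # T') = m"
    unfolding T(2)[symmetric] T' by (rule ext) (simp add: mass_at_def)
  ultimately show ?case by blast
qed

section \<open>Splitting off a system by Caratheodory's theorem\<close>

lemma balanced_center_in_convex_hull:
  fixes m :: "real ^ ('n::finite) \<Rightarrow> real"
  assumes fin: "finite {x. m x \<noteq> 0}" and nonneg: "\<And>x. m x \<ge> 0"
    and nonempty: "{x. m x \<noteq> 0} \<noteq> {}" and bal: "balanced_about c m"
  shows "c \<in> convex hull {x. m x \<noteq> 0}"
proof -
  let ?A = "{x. m x \<noteq> 0}"
  define M where "M = sum m ?A"
  have "M > 0" unfolding M_def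
    using fin nonempty nonneg by (intro sum_pos) (auto simp: less_le)
  have "(\<Sum>x\<in>?A. m x *\<^sub>R x) = M *\<^sub>R c"
    using bal by (simp add: balanced_about_def M_def algebra_simps sum_subtractf scaleR_sum_left)
  moreover have "(\<Sum>x\<in>?A. (m x / M) *\<^sub>R x) = (1 / M) *\<^sub>R (\<Sum>x\<in>?A. m x *\<^sub>R x)"
    by (simp add: scaleR_sum_right)
  ultimately have "(\<Sum>x\<in>?A. (m x / M) *\<^sub>R x) = c"
    using \<open>M > 0\<close> by simp
  moreover have "(\<Sum>x\<in>?A. m x / M) = 1"
    using \<open>M > 0\<close> by (simp add: M_def flip: sum_divide_distrib)
  ultimately show ?thesis
    using fin nonneg \<open>M > 0\<close> convex_hull_finite[OF fin] by (auto intro!: exI[of _ "\<lambda>x. m x / M"])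
qed

text \<open>
  The summand \<open>p\<close> is the largest multiple \<open>t u\<close> below \<open>m\<close> of the Caratheodory weights \<open>u\<close>.
  The point at which the minimum of \<open>m / u\<close> is attained drops out of the support of \<open>m - p\<close>.
\<close>

lemma split_off_balanced_summand:
  fixes m :: "real ^ ('n::finite) \<Rightarrow> real"
  assumes fin: "finite {x. m x \<noteq> 0}" and nonneg: "\<And>x. m x \<ge> 0"
    and nonempty: "{x. m x \<noteq> 0} \<noteq> {}" and bal: "balanced_about c m"
  obtains p where "\<And>x. p x \<ge> 0" and "\<And>x. p x \<le> m x" and "balanced_about c p"
    and "{x. p x \<noteq> 0} \<noteq> {}" and "card {x. p x \<noteq> 0} \<le> CARD('n) + 1"
    and "balanced_about c (\<lambda>x. m x - p x)" and "{x. m x - p x \<noteq> 0} \<subset> {x. m x \<noteq> 0}"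
proof -
  let ?A = "{x. m x \<noteq> 0}"
  have "c \<in> convex hull ?A"
    using balanced_center_in_convex_hull[OF assms] .
  then obtain B where B: "finite B" "B \<subseteq> ?A" "card B \<le> CARD('n) + 1" and "c \<in> convex hull B"
    unfolding caratheodory[of ?A] by auto
  then obtain v where v: "\<forall>x\<in>B. v x \<ge> 0" "sum v B = 1" "(\<Sum>x\<in>B. v x *\<^sub>R x) = c"
    using convex_hull_finite[OF B(1)] by auto
  define u where "u x = (if x \<in> B then v x else 0)" for x
  have u_nonneg: "u x \<ge> 0" for x using v(1) by (simp add: u_def)
  have supp_u: "{x. u x \<noteq> 0} \<subseteq> B" by (auto simp: u_def)
  then have fin_u: "finite {x. u x \<noteq> 0}" using B(1) finite_subset by blast
  have "(\<Sum>x\<in>B. u x *\<^sub>R (x - c)) = (\<Sum>x\<in>B. v x *\<^sub>R x) - sum v B *\<^sub>R c"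
    by (simp add: u_def algebra_simps sum_subtractf scaleR_sum_left)
  then have bal_u: "(\<Sum>x\<in>B. u x *\<^sub>R (x - c)) = 0" using v by simp
  have ne_u: "{x. u x \<noteq> 0} \<noteq> {}"
  proof
    assume "{x. u x \<noteq> 0} = {}"
    then have "sum v B = 0" by (intro sum.neutral) (auto simp: u_def split: if_splits)
    then show False using v(2) by simp
  qed
  define t where "t = Min ((\<lambda>x. m x / u x) ` {x. u x \<noteq> 0})"
  have "t \<in> (\<lambda>x. m x / u x) ` {x. u x \<noteq> 0}"
    unfolding t_def using fin_u ne_u by (intro Min_in) auto
  then obtain y where y: "u y \<noteq> 0" "t = m y / u y" by auto
  have "y \<in> ?A" using y(1) supp_u B(2) by blast
  then have "m y > 0" using nonneg[of y] by simp
  then have t_pos: "t > 0" using y u_nonneg[of y] by simp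
  have le: "t * u x \<le> m x" for x
  proof (cases "u x = 0")
    case False
    then have "t \<le> m x / u x" unfolding t_def using fin_u by (intro Min_le) auto
    then show ?thesis using False u_nonneg[of x] by (simp add: pos_le_divide_eq less_le)
  qed (simp add: nonneg)
  let ?p = "\<lambda>x. t * u x"
  have supp_p: "{x. ?p x \<noteq> 0} = {x. u x \<noteq> 0}" using t_pos by auto
  have "(\<Sum>x\<in>B. ?p x *\<^sub>R (x - c)) = t *\<^sub>R (\<Sum>x\<in>B. u x *\<^sub>R (x - c))"
    by (simp add: scaleR_sum_right)
  then have bal_p: "balanced_about c ?p"
    using bal_u supp_u by (subst balanced_about_iff_sum[OF B(1)]) (simp_all only: supp_p, simp)
  have supp_diff: "{x. m x - ?p x \<noteq> 0} \<subseteq> ?A" using supp_u B(2) by auto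
  show thesis
  proof (rule that[of ?p])
    show "?p x \<ge> 0" for x using t_pos u_nonneg by simp
    show "?p x \<le> m x" for x by (rule le)
    show "balanced_about c ?p" by (rule bal_p)
    show "{x. ?p x \<noteq> 0} \<noteq> {}" using ne_u supp_p by simp
    show "card {x. ?p x \<noteq> 0} \<le> CARD('n) + 1"
      using card_mono[OF B(1) supp_u] B(3) by (simp only: supp_p)
    have "{x. ?p x \<noteq> 0} \<subseteq> ?A" using supp_p supp_u B(2) by simp
    then have "(\<Sum>x\<in>?A. ?p x *\<^sub>R (x - c)) = 0"
      by (rule balanced_about_iff_sum[OF fin, THEN iffD1, OF _ bal_p])
    moreover have "(\<Sum>x\<in>?A. m x *\<^sub>R (x - c)) = 0"
      using bal unfolding balanced_about_def .
    ultimately have "(\<Sum>x\<in>?A. (m x - ?p x) *\<^sub>R (x - c)) = 0"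
      by (simp only: scaleR_left_diff_distrib sum_subtractf diff_self)
    then show "balanced_about c (\<lambda>x. m x - ?p x)"
      by (rule balanced_about_iff_sum[OF fin supp_diff, THEN iffD2])
    have "y \<notin> {x. m x - ?p x \<noteq> 0}" using y by simp
    then show "{x. m x - ?p x \<noteq> 0} \<subset> ?A" using supp_diff \<open>y \<in> ?A\<close> by blast
  qed
qed

text \<open>
  The \<open>max\<close> is what the induction needs: the support can shrink below \<open>n + 1\<close> points in a single
  step, and the remainder then still takes one system.
\<close>

lemma balanced_decomposition:
  fixes m :: "real ^ ('n::finite) \<Rightarrow> real"
  assumes "finite {x. m x \<noteq> 0}" and "\<And>x. m x \<ge> 0"
    and "{x. m x \<noteq> 0} \<noteq> {}" and "balanced_about c m"
  shows "\<exists>Ts. (\<forall>x. m x = (\<Sum>T\<leftarrow>Ts. mass_at T x)) \<and>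
    length Ts \<le> max 1 (card {x. m x \<noteq> 0} - CARD('n)) \<and>
    (\<forall>T\<in>set Ts. point_mass_system (CARD('n) + 1) T \<and> balanced_about c (mass_at T))"
  using assms
proof (induction "card {x. m x \<noteq> 0}" arbitrary: m rule: less_induct)
  case less
  show ?case
  proof (cases "card {x. m x \<noteq> 0} \<le> CARD('n) + 1")
    case True
    obtain T where "point_mass_system (CARD('n) + 1) T" "mass_at T = m"
      using point_mass_system_with_mass_function[OF less.prems(1-3) True] by blast
    then show ?thesis using less.prems(4) by (intro exI[of _ "[T]"]) auto
  next
    case False
    obtain p where p: "\<And>x. p x \<ge> 0" "\<And>x. p x \<le> m x" "balanced_about c p"
      "{x. p x \<noteq> 0} \<noteq> {}" "card {x. p x \<noteq> 0} \<le> CARD('n) + 1"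
      "balanced_about c (\<lambda>x. m x - p x)" "{x. m x - p x \<noteq> 0} \<subset> {x. m x \<noteq> 0}"
      using split_off_balanced_summand[OF less.prems] by blast
    have "{x. p x \<noteq> 0} \<subseteq> {x. m x \<noteq> 0}"
    proof
      fix x assume "x \<in> {x. p x \<noteq> 0}"
      then show "x \<in> {x. m x \<noteq> 0}" using p(1,2)[of x] by auto
    qed
    then have "finite {x. p x \<noteq> 0}" using less.prems(1) finite_subset by blast
    then obtain T where T: "point_mass_system (CARD('n) + 1) T" "mass_at T = p"
      using point_mass_system_with_mass_function[of p] p by blast
    have smaller: "card {x. m x - p x \<noteq> 0} < card {x. m x \<noteq> 0}"
      using psubset_card_mono[OF less.prems(1) p(7)] .
    have "\<exists>Ts. (\<forall>x. m x - p x = (\<Sum>T\<leftarrow>Ts. mass_at T x)) \<and>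
        length Ts \<le> max 1 (card {x. m x - p x \<noteq> 0} - CARD('n)) \<and>
        (\<forall>T\<in>set Ts. point_mass_system (CARD('n) + 1) T \<and> balanced_about c (mass_at T))"
      \<comment> \<open>The remainder is zero when \<open>m\<close> is itself a multiple of the Caratheodory weights.\<close>
    proof (cases "{x. m x - p x \<noteq> 0} = {}")
      case True
      then show ?thesis by (intro exI[of _ "[]"]) auto
    next
      case False
      have "finite {x. m x - p x \<noteq> 0}"
        using p(7) less.prems(1) finite_subset by blast
      moreover have "m x - p x \<ge> 0" for x using p(2)[of x] by simp
      ultimately show ?thesis
        using less.hyps[OF smaller] False p(6) by blast
    qed
    then obtain Ts where Ts: "\<And>x. m x - p x = (\<Sum>T\<leftarrow>Ts. mass_at T x)"
      "length Ts \<le> max 1 (card {x. m x - p x \<noteq> 0} - CARD('n))"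
      "\<forall>T\<in>set Ts. point_mass_system (CARD('n) + 1) T \<and> balanced_about c (mass_at T)"
      by blast
    have "m x = (\<Sum>T\<leftarrow>T # Ts. mass_at T x)" for x
      using Ts(1)[of x] T(2) by simp
    moreover have "length (T # Ts) \<le> max 1 (card {x. m x \<noteq> 0} - CARD('n))"
      using Ts(2) smaller False by auto
    moreover have "\<forall>T\<in>set (T # Ts). point_mass_system (CARD('n) + 1) T
        \<and> balanced_about c (mass_at T)"
      using Ts(3) T p(3) by simp
    ultimately show ?thesis by blast
  qed
qed

theorem theorem12p5:
  fixes S :: "('n::finite) point_mass list" and k :: nat
  assumes "point_mass_system k S" and "k > CARD('n)"
  shows "\<exists>Ts. decomposes_into S Ts \<and> length Ts \<le> k - CARD('n) \<and>
    (\<forall>T \<in> set Ts. point_mass_system (CARD('n) + 1) T \<and> center_of_mass T = center_of_mass S)"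
proof -
  let ?A = "{x. mass_at S x \<noteq> 0}"
  have supp: "?A = fst ` set S" by (rule support_mass_at[OF assms(1)])
  have len: "length S = k" using assms(1) by (simp add: point_mass_system_def)
  have fin: "finite ?A" unfolding supp by simp
  have "set S \<noteq> {}" using len assms(2) by auto
  then have ne: "?A \<noteq> {}" unfolding supp by simp
  have "balanced_about (center_of_mass S) (mass_at S)"
    by (rule center_of_mass_eq_iff_balanced[OF assms(1), THEN iffD1, OF _ refl]) (use assms(2) in simp)
  then obtain Ts where Ts: "\<forall>x. mass_at S x = (\<Sum>T\<leftarrow>Ts. mass_at T x)"
    "length Ts \<le> max 1 (card ?A - CARD('n))"
    "\<forall>T\<in>set Ts. point_mass_system (CARD('n) + 1) T
      \<and> balanced_about (center_of_mass S) (mass_at T)"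
    using balanced_decomposition[OF fin mass_at_nonneg[OF assms(1)] ne] by blast
  have "card ?A \<le> k"
    unfolding supp using card_image_le[of "set S" fst] card_length[of S] len by simp
  then have "length Ts \<le> k - CARD('n)" using Ts(2) assms(2) by auto
  moreover have "\<forall>T\<in>set Ts. point_mass_system (CARD('n) + 1) T
      \<and> center_of_mass T = center_of_mass S"
    using Ts(3) center_of_mass_eq_iff_balanced[of "CARD('n) + 1"] by auto
  ultimately show ?thesis using Ts(1) unfolding decomposes_into_def by blast
qed

end
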